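(* Let $P$ be a planar upho poset of up-degree $b$, with a fixed planar Hasse diagram, and for $i\ge 2$ let $a_i$ be the number of root-bifurcated elements of rank $i$ (only finitely many $a_i$ are nonzero; say $a_i=0$ for $i>n$). Then the rank-generating function of $P$ is $Q(x)^{-1}$, where $$Q(x)=1-bx+a_2x^2+a_3x^3+\cdots+a_nx^n,$$ with $b,a_2,\ldots,a_n\in\mathbb{Z}_{\ge0}$, and the coefficients of $Q$ sum to at most $0$, i.e. $Q(1)\le 0$.
   Context: A poset $P$ is ranked if it has a disjoint decomposition $P=P_0\sqcup P_1\sqcup\cdots$ such that whenever $x\in P_i$ and $y$ covers $x$, then $y\in P_{i+1}$; it is of finite type if every $P_i$ is finite. The rank-generating function is $F_P(x)=\sum_{k\ge0}|P_k|x^k$. For $s\in P$, $V_{P,s}=\{t\in P:t\ge s\}$. A ranked poset $P$ is upho if it is of finite type and $V_{P,s}\cong P$ for all $s\in P$; it then has a unique minimum $\hat0$, and every element has the same up-degree (number of elements covering it), called the up-degree of $P$. A ranked poset is planar if it has a Hasse diagram in which every element of rank $i$ is drawn at $y$-coordinate $i$ and no two edges intersect; fix such a diagram. Any two elements of a planar upho poset have a meet. Two elements are adjacent if they have the same rank and no other element lies between them in the fixed planar Hasse diagram. An element $v$ is root-bifurcated if it covers exactly two elements, these two are adjacent, and their meet is $\hat0$.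
   Formalization: Q(1) ≤ 0 is claimed only for b ≥ 1 (it fails for the one-element poset, where Q = 1); "ranked" also requires that rank strictly increases along the order and that P_0 is nonempty, without which the formula for the rank-generating function can fail. *)

theory Defs
  imports "HOL-Analysis.Analysis" "HOL-Library.Lub_Glb"
    "HOL-Computational_Algebra.Polynomial_FPS"
begin

text \<open>A poset is a type of class \<open>order\<close>. A decomposition into ranks is given by the
  function \<open>rk\<close> sending an element to the index of its part, so that the \<open>k\<close>-th part is
  \<open>{x. rk x = k}\<close>.\<close>

definition covers :: "'a::order \<Rightarrow> 'a \<Rightarrow> bool" where
  "covers y x \<longleftrightarrow> x < y \<and> \<not> (\<exists>z. x < z \<and> z < y)"

text \<open>The cover condition alone does not tie the rank to the order (it is vacuous for dense
  orders), nor does it fix where the ranks start. The first and third conjuncts express the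
  usual understanding of a ranked poset: the rank increases along the order, and the ranks
  start at \<open>0\<close>.\<close>

definition ranked :: "('a::order \<Rightarrow> nat) \<Rightarrow> bool" where
  "ranked rk \<longleftrightarrow>
     (\<forall>x y. x < y \<longrightarrow> rk x < rk y) \<and>
     (\<forall>x y. covers y x \<longrightarrow> rk y = rk x + 1) \<and>
     (\<exists>x. rk x = 0)"

definition finite_type :: "('a::order \<Rightarrow> nat) \<Rightarrow> bool" where
  "finite_type rk \<longleftrightarrow> (\<forall>k. finite {x. rk x = k})"

definition order_isomorphic :: "'a::order set \<Rightarrow> 'b::order set \<Rightarrow> bool" where
  "order_isomorphic A B \<longleftrightarrow>
     (\<exists>f. bij_betw f A B \<and> (\<forall>x\<in>A. \<forall>y\<in>A. x \<le> y \<longleftrightarrow> f x \<le> f y))"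

definition upho :: "('a::order \<Rightarrow> nat) \<Rightarrow> bool" where
  "upho rk \<longleftrightarrow> ranked rk \<and> finite_type rk \<and>
     (\<forall>s::'a. order_isomorphic {s..} (UNIV :: 'a set))"

definition has_up_degree :: "'a::order itself \<Rightarrow> nat \<Rightarrow> bool" where
  "has_up_degree _ b \<longleftrightarrow> (\<forall>x::'a. card {y. covers y x} = b)"

definition zero_hat :: "'a::order" where
  "zero_hat = (LEAST x. True)"

definition rank_gen_fun :: "('a::order \<Rightarrow> nat) \<Rightarrow> rat fps" where
  "rank_gen_fun rk = Abs_fps (\<lambda>k. of_nat (card {x. rk x = k}))"

text \<open>A diagram is determined by the horizontal coordinates \<open>h\<close> of the elements; edges are
  straight line segments. Distinct edges may only meet in a common endpoint.\<close>

definition hasse_point :: "('a::order \<Rightarrow> nat) \<Rightarrow> ('a \<Rightarrow> real) \<Rightarrow> 'a \<Rightarrow> real \<times> real" where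
  "hasse_point rk h x = (h x, real (rk x))"

definition planar_hasse_diagram :: "('a::order \<Rightarrow> nat) \<Rightarrow> ('a \<Rightarrow> real) \<Rightarrow> bool" where
  "planar_hasse_diagram rk h \<longleftrightarrow>
     inj (hasse_point rk h) \<and>
     (\<forall>x y x' y'. covers y x \<and> covers y' x' \<and> (x, y) \<noteq> (x', y') \<longrightarrow>
        closed_segment (hasse_point rk h x) (hasse_point rk h y) \<inter>
        closed_segment (hasse_point rk h x') (hasse_point rk h y')
          \<subseteq> hasse_point rk h ` ({x, y} \<inter> {x', y'}))"

definition adjacent :: "('a::order \<Rightarrow> nat) \<Rightarrow> ('a \<Rightarrow> real) \<Rightarrow> 'a \<Rightarrow> 'a \<Rightarrow> bool" where
  "adjacent rk h u w \<longleftrightarrow> u \<noteq> w \<and> rk u = rk w \<and>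
     \<not> (\<exists>z. rk z = rk u \<and> (h u < h z \<and> h z < h w \<or> h w < h z \<and> h z < h u))"

definition root_bifurcated :: "('a::order \<Rightarrow> nat) \<Rightarrow> ('a \<Rightarrow> real) \<Rightarrow> 'a \<Rightarrow> bool" where
  "root_bifurcated rk h v \<longleftrightarrow>
     (\<exists>u w. u \<noteq> w \<and> {x. covers v x} = {u, w} \<and> adjacent rk h u w \<and>
        isGlb UNIV {u, w} zero_hat)"

definition num_root_bifurcated :: "('a::order \<Rightarrow> nat) \<Rightarrow> ('a \<Rightarrow> real) \<Rightarrow> nat \<Rightarrow> nat" where
  "num_root_bifurcated rk h i = card {v. rk v = i \<and> root_bifurcated rk h v}"

definition Q_poly :: "nat \<Rightarrow> (nat \<Rightarrow> nat) \<Rightarrow> nat \<Rightarrow> rat poly" where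
  "Q_poly b a n = 1 - monom (of_nat b) 1 + (\<Sum>i=2..n. monom (of_nat (a i)) i)"

end

theory Submission
  imports Defs
begin

text \<open>
  Count the covering pairs between ranks \<open>k\<close> and \<open>k + 1\<close> twice. From below there are
  \<open>b |P\<^sub>k|\<close> of them. From above, planarity shows that an element covers at most two elements, so
  there are \<open>|P\<^sub>k\<^sub>+\<^sub>1|\<close> plus the number of elements of rank \<open>k + 1\<close> that cover two. Such an element
  \<open>v\<close> is sent to the meet \<open>m\<close> of the two elements it covers, and it is root-bifurcated in the
  copy \<open>{m..}\<close> of the poset; this is a convolution, and \<open>F Q = 1\<close> follows. For \<open>Q(1) \<le> 0\<close>, a
  root-bifurcated element \<open>v\<close> covering \<open>u\<close> and \<open>w\<close> determines, and is determined by, the pair of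
  neighbouring atoms between which the atoms below \<open>u\<close> and those below \<open>w\<close> are separated; there are \<open>b - 1\<close> such pairs.
\<close>

lemma isGlb_pair_iff:
  fixes u w m :: "'a::order"
  shows "isGlb UNIV {u, w} m \<longleftrightarrow> m \<le> u \<and> m \<le> w \<and> (\<forall>x. x \<le> u \<and> x \<le> w \<longrightarrow> x \<le> m)"
  unfolding isGlb_def greatestP_def isLb_def setle_def setge_def by auto

locale planar_upho =
  fixes rk :: "'a::order \<Rightarrow> nat" and h :: "'a \<Rightarrow> real" and b :: nat
  assumes upho: "upho rk"
    and planar: "planar_hasse_diagram rk h"
    and up_degree: "has_up_degree TYPE('a) b"
begin

section \<open>Ranks, covers and chains in an upho poset\<close>

lemma rk_less: "x < y \<Longrightarrow> rk x < rk y"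
  using upho by (auto simp: upho_def ranked_def)

lemma rk_le: "x \<le> y \<Longrightarrow> rk x \<le> rk y"
  using rk_less by (auto simp: le_less)

lemma eq_if_le_rk: "x \<le> y \<Longrightarrow> rk y \<le> rk x \<Longrightarrow> x = y"
  using rk_less[of x y] by (auto simp: le_less)

lemma finite_rank: "finite {x. rk x = k}"
  using upho by (auto simp: upho_def finite_type_def)

lemma card_covers: "card {y. covers y (x::'a)} = b"
  using up_degree by (auto simp: has_up_degree_def)

text \<open>Ranks increase strictly, so nothing fits between comparable elements of consecutive
  ranks. Covering is used in this form throughout.\<close>

lemma covers_iff: "covers y x \<longleftrightarrow> x < y \<and> rk y = Suc (rk x)"
proof
  show "covers y x \<Longrightarrow> x < y \<and> rk y = Suc (rk x)"
    using upho by (auto simp: upho_def ranked_def covers_def)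
  assume "x < y \<and> rk y = Suc (rk x)"
  then show "covers y x"
    unfolding covers_def using rk_less by (metis Suc_leI leD)
qed

lemma finite_covers: "finite {y. covers y (x::'a)}" "finite {x. covers (y::'a) x}"
  by (rule finite_subset[OF _ finite_rank[of "Suc (rk x)"]], force simp: covers_iff)
    (rule finite_subset[OF _ finite_rank[of "rk y - 1"]], force simp: covers_iff)

lemma inj_h: "rk x = rk y \<Longrightarrow> h x = h y \<Longrightarrow> x = y"
  using planar by (auto simp: planar_hasse_diagram_def hasse_point_def inj_def)

text \<open>An element of least rank among those above \<open>x\<close> and at most \<open>y\<close>
  covers \<open>x\<close>; the rank function supplies the well-foundedness.\<close>

lemma exists_cover_below:
  fixes x y :: 'a
  assumes "x < y"
  obtains z where "covers z x" "z \<le> y"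
proof -
  obtain z where z: "x < z" "z \<le> y" and least: "\<And>t. x < t \<Longrightarrow> t \<le> y \<Longrightarrow> rk z \<le> rk t"
    using ex_has_least_nat[of "\<lambda>z. x < z \<and> z \<le> y" y rk] assms by auto
  have "covers z x"
    unfolding covers_def
  proof (intro conjI notI)
    assume "\<exists>t. x < t \<and> t < z"
    then obtain t where "x < t" "t < z"
      by blast
    then have "rk z \<le> rk t" "rk t < rk z"
      using least z rk_less by auto
    then show False
      by simp
  qed (fact z)
  with z that show thesis
    by blast
qed

lemma exists_between_rk:
  assumes "x \<le> y" "rk x \<le> j" "j \<le> rk y"
  obtains z where "x \<le> z" "z \<le> y" "rk z = j"
proof -
  have "j \<le> rk y \<longrightarrow> (\<exists>z. x \<le> z \<and> z \<le> y \<and> rk z = j)"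
    using assms(2)
  proof (induction j rule: dec_induct)
    case base
    then show ?case
      using assms(1) by auto
  next
    case (step j)
    show ?case
    proof
      assume "Suc j \<le> rk y"
      then obtain z where z: "x \<le> z" "z \<le> y" "rk z = j"
        using step.IH by auto
      with \<open>Suc j \<le> rk y\<close> have "z < y"
        by (auto simp: le_less)
      then obtain t where "covers t z" "t \<le> y"
        by (rule exists_cover_below)
      with z have "x \<le> t" "rk t = Suc j"
        by (auto simp: covers_iff)
      with \<open>t \<le> y\<close> show "\<exists>z. x \<le> z \<and> z \<le> y \<and> rk z = Suc j"
        by blast
    qed
  qed
  with assms(3) that show thesis
    by blast
qed

text \<open>An isomorphism of \<open>{s..}\<close> onto the whole poset carries its least element
  \<open>s\<close> to a least element, so the \<open>LEAST\<close> in \<open>zero_hat\<close> is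
  attained.\<close>

lemma zero_hat_le: "zero_hat \<le> (x::'a)"
proof -
  obtain s :: 'a where True by blast
  obtain f where f: "bij_betw f {s..} (UNIV::'a set)"
    and mono: "\<And>x y. x \<in> {s..} \<Longrightarrow> y \<in> {s..} \<Longrightarrow> x \<le> y \<longleftrightarrow> f x \<le> f y"
    using upho unfolding upho_def order_isomorphic_def by metis
  have least: "f s \<le> y" for y
  proof -
    have "y \<in> f ` {s..}"
      using f by (auto simp: bij_betw_def)
    then show ?thesis
      using mono by auto
  qed
  then have "zero_hat = f s"
    unfolding zero_hat_def by (intro Least_equality) auto
  with least show ?thesis
    by simp
qed

lemma rk_zero_hat: "rk zero_hat = 0"
proof -
  obtain x where "rk x = 0"
    using upho by (auto simp: upho_def ranked_def)
  then show ?thesis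
    using rk_le[OF zero_hat_le, of x] by simp
qed

lemma rk_eq_0_iff: "rk x = 0 \<longleftrightarrow> x = zero_hat"
  using eq_if_le_rk[OF zero_hat_le, of x] rk_zero_hat by auto

lemma exists_below_rk:
  assumes "j \<le> rk y"
  obtains z where "z \<le> y" "rk z = j"
  using exists_between_rk[OF zero_hat_le[of y] _ assms] rk_zero_hat by auto

lemma covered_exists:
  assumes "rk v > 0"
  obtains u where "covers v u"
proof -
  obtain u where "u \<le> v" "rk u = rk v - 1"
    using exists_below_rk[of "rk v - 1" v] by auto
  with assms have "covers v u"
    by (auto simp: covers_iff le_less)
  with that show thesis .
qed

lemma up_degree_pos:
  assumes "covers (v::'a) u"
  shows "b > 0"
  using card_covers[of u] finite_covers(1)[of u] assms by (auto simp: card_gt_0_iff)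

lemma exists_above_rk:
  assumes "b > 0" "rk x \<le> j"
  obtains y where "x \<le> y" "rk y = j"
proof -
  from assms(2) have "\<exists>y. x \<le> y \<and> rk y = j"
  proof (induction j rule: dec_induct)
    case (step j)
    then obtain y where y: "x \<le> y" "rk y = j"
      by blast
    have "{t. covers t y} \<noteq> {}"
      using card_covers[of y] assms(1) by force
    then obtain t where "covers t y"
      by blast
    with y show ?case
      by (intro exI[of _ t]) (auto simp: covers_iff)
  qed auto
  with that show thesis
    by blast
qed

subsection \<open>Consequences of planarity\<close>

text \<open>If the upper ends were in strictly reversed order, the two edges would cross at a point
  that is not a common endpoint. Equality is possible, since the edges may share their upper
  end.\<close>

lemma covers_mono_h:
  assumes c: "covers y x" "covers y' x'" and rk: "rk x = rk x'" and lt: "h x < h x'"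
  shows "h y \<le> h y'"
proof (rule ccontr)
  assume "\<not> h y \<le> h y'"
  then have gt: "h y - h y' > 0"
    by simp
  \<comment> \<open>At height \<open>s\<close> above the lower rank the horizontal distance from the
    first edge to the second is \<open>(h x' - h x) - s * d\<close>; it vanishes at
    \<open>s = t\<close>.\<close>
  define d where "d = (h x' - h x) + (h y - h y')"
  define t where "t = (h x' - h x) / d"
  define p where "p = ((1 - t) * h x + t * h y, real (rk x) + t)"
  have d: "d > 0"
    using gt lt by (simp add: d_def)
  have t: "0 \<le> t" "t \<le> 1"
    using gt lt d by (auto simp: t_def d_def)
  have "t * d = h x' - h x"
    using d by (simp add: t_def)
  then have eq: "(1 - t) * h x + t * h y = (1 - t) * h x' + t * h y'"
    unfolding d_def by (simp add: algebra_simps)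
  have "p \<in> closed_segment (hasse_point rk h x) (hasse_point rk h y)"
    unfolding closed_segment_def p_def hasse_point_def using t c
    by (auto intro!: exI[of _ t] simp: covers_iff algebra_simps)
  moreover have "p \<in> closed_segment (hasse_point rk h x') (hasse_point rk h y')"
    unfolding closed_segment_def p_def hasse_point_def eq using t c rk
    by (auto intro!: exI[of _ t] simp: covers_iff algebra_simps)
  moreover have "{x, y} \<inter> {x', y'} = {}"
    using c rk lt gt by (auto simp: covers_iff)
  moreover have "(x, y) \<noteq> (x', y')"
    using lt by auto
  ultimately show False
    using planar c unfolding planar_hasse_diagram_def by blast
qed

text \<open>Climb both chains one rank at a time. By \<open>covers_mono_h\<close> the first stays
  weakly to the left of the second; as the positions at the top are weakly reversed, the chains must
  coincide at some rank.\<close>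

lemma crossing_chains_meet:
  assumes "rk x = rk x'" "rk y = rk y'" "x \<le> y" "x' \<le> y'" "h x \<le> h x'" "h y' \<le> h y"
  shows "\<exists>z. x \<le> z \<and> z \<le> y \<and> x' \<le> z \<and> z \<le> y'"
  using assms
proof (induction "rk y - rk x" arbitrary: x x')
  case 0
  then have "rk y \<le> rk x"
    by simp
  then have "x = y" "x' = y'"
    using 0 by (auto intro: eq_if_le_rk)
  then show ?case
    using 0 inj_h[of x x'] by auto
next
  case (Suc n)
  show ?case
  proof (cases "h x = h x'")
    case True
    then show ?thesis
      using Suc.prems inj_h[of x x'] by auto
  next
    case False
    have "x < y" "x' < y'"
      using Suc.prems Suc.hyps(2) by (auto simp: le_less)
    then obtain t t' where t: "covers t x" "t \<le> y" "covers t' x'" "t' \<le> y'"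
      by (meson exists_cover_below)
    then have "h t \<le> h t'"
      using covers_mono_h False Suc.prems by force
    moreover have "n = rk y - rk t" "rk t = rk t'"
      using t Suc.hyps(2) Suc.prems(1) by (auto simp: covers_iff)
    ultimately obtain z where "t \<le> z \<and> z \<le> y \<and> t' \<le> z \<and> z \<le> y'"
      using Suc.hyps(1)[of t t'] t Suc.prems by blast
    moreover have "x \<le> t" "x' \<le> t'"
      using t by (auto simp: covers_iff)
    ultimately show ?thesis
      by (meson order.trans)
  qed
qed

section \<open>Existence of meets\<close>

text \<open>Let \<open>m\<close> be a common lower bound of greatest rank, and let \<open>n\<close>
  have greatest rank among the lower bounds above a given lower bound \<open>x\<close>. For
  \<open>k\<close> below \<open>m\<close> at the rank of \<open>n\<close>, crossing chains yield a
  lower bound \<open>z\<close> above both \<open>k\<close> and \<open>n\<close>. Maximality gives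
  \<open>n = z\<close>, so \<open>k \<le> n\<close>, hence \<open>k = n\<close> and
  \<open>x \<le> m\<close>.\<close>

lemma exists_meet:
  fixes u w :: 'a
  assumes "rk u = rk w"
  obtains m where "isGlb UNIV {u, w} m"
proof -
  let ?L = "\<lambda>x. x \<le> u \<and> x \<le> w"
  have bound: "\<forall>x. ?L x \<longrightarrow> rk x < Suc (rk u)"
    using rk_le by (auto simp: less_Suc_eq_le)
  obtain m where m: "?L m" "\<And>x. ?L x \<Longrightarrow> rk x \<le> rk m"
    using ex_has_greatest_nat[of ?L zero_hat rk "Suc (rk u)"] zero_hat_le bound by auto
  have "x \<le> m" if x: "?L x" for x
  proof -
    have "\<forall>y. ?L y \<and> x \<le> y \<longrightarrow> rk y < Suc (rk u)"
      using bound by blast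
    then obtain n where n: "?L n" "x \<le> n" "\<And>y. ?L y \<Longrightarrow> x \<le> y \<Longrightarrow> rk y \<le> rk n"
      using ex_has_greatest_nat[of "\<lambda>y. ?L y \<and> x \<le> y" x rk "Suc (rk u)"] x by auto
    obtain k where k: "k \<le> m" "rk k = rk n"
      using exists_below_rk[of "rk n" m] m n by auto
    have ku: "k \<le> u" "k \<le> w"
      using k m by auto
    \<comment> \<open>Both \<open>k\<close> and \<open>n\<close> lie below both \<open>u\<close> and
      \<open>w\<close>, so the targets can be chosen freely: the left one of \<open>k\<close>,
      \<open>n\<close> is joined to the right one of \<open>u\<close>, \<open>w\<close>, and the
      right one to the left one. These chains cross.\<close>
    have "\<exists>z. k \<le> z \<and> n \<le> z \<and> ?L z"
    proof (cases "(h k \<le> h n) = (h u \<le> h w)")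
      case True
      show ?thesis
      proof (cases "h k \<le> h n")
        case kn: True
        with True show ?thesis
          using crossing_chains_meet[of k n w u] assms k ku n by metis
      next
        case False
        with True show ?thesis
          using crossing_chains_meet[of n k u w] assms k ku n by (metis linear)
      qed
    next
      case False
      show ?thesis
      proof (cases "h k \<le> h n")
        case kn: True
        with False show ?thesis
          using crossing_chains_meet[of k n u w] assms k ku n by (metis linear)
      next
        case kn: False
        with False show ?thesis
          using crossing_chains_meet[of n k w u] assms k ku n by (metis linear)
      qed
    qed
    then obtain z where z: "k \<le> z" "n \<le> z" "?L z"
      by blast
    then have "n = z"
      using n by (intro eq_if_le_rk) auto
    then have "k = n"
      using z k by (intro eq_if_le_rk) auto
    then show ?thesis
      using n k by auto
  qed
  with m that show thesis
    by (auto simp: isGlb_pair_iff)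
qed

section \<open>An element covers at most two elements\<close>

text \<open>By induction two elements of equal rank cover a common element, which has only one
  cover. This excludes the degenerate case in \<open>not_covers_three\<close>.\<close>

lemma up_degree_1_chain:
  assumes "b = 1" "rk x = rk y"
  shows "x = y"
  using assms(2)
proof (induction "rk x" arbitrary: x y)
  case 0
  then show ?case
    by (metis rk_eq_0_iff)
next
  case (Suc n)
  then have "rk x > 0" "rk y > 0"
    by auto
  obtain s where s: "covers x s"
    using \<open>rk x > 0\<close> by (rule covered_exists)
  obtain t where t: "covers y t"
    using \<open>rk y > 0\<close> by (rule covered_exists)
  from s t have "n = rk s" "rk s = rk t"
    using Suc.hyps(2) Suc.prems by (auto simp: covers_iff)
  then have "s = t"
    by (rule Suc.hyps(1))
  then have "x \<in> {z. covers z s}" "y \<in> {z. covers z s}"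
    using s t by auto
  then show ?case
    using card_covers[of s] assms(1) by (metis card_1_singletonE singletonD)
qed

text \<open>Every cover of the middle element \<open>w\<close> is squeezed onto \<open>v\<close> by
  the edges from \<open>u\<close> and \<open>z\<close>. So \<open>w\<close> has a single cover,
  \<open>b = 1\<close>, and the poset is a chain, contrary to \<open>u\<close> and \<open>w\<close>
  being distinct.\<close>

lemma not_covers_three:
  assumes "covers v u" "covers v w" "covers v z" "h u < h w" "h w < h z"
  shows False
proof -
  have rk: "rk u = rk w" "rk w = rk z"
    using assms by (auto simp: covers_iff)
  have "y = v" if y: "covers y w" for y
  proof (rule inj_h)
    show "rk y = rk v"
      using y assms(2) by (simp add: covers_iff)
    have "h v \<le> h y" "h y \<le> h v"
      by (rule covers_mono_h[OF assms(1) y rk(1) assms(4)])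
        (rule covers_mono_h[OF y assms(3) rk(2) assms(5)])
    then show "h y = h v"
      by simp
  qed
  then have "{y. covers y w} = {v}"
    using assms(2) by blast
  then have "b = 1"
    using card_covers[of w] by simp
  then show False
    using up_degree_1_chain[of u w] rk(1) assms(4) by simp
qed

text \<open>Take the leftmost and the rightmost covered element; any other would be a third one
  strictly between them. The case \<open>u = w\<close> is included and means that just one element
  is covered.\<close>

lemma covered_eq_pair:
  assumes "rk v > 0"
  obtains u w where "{x. covers v x} = {u, w}"
proof -
  obtain s where "covers v s"
    using assms by (rule covered_exists)
  then have ne: "{x. covers v x} \<noteq> {}"
    by blast
  have fin: "finite (h ` {x. covers v x})"
    by (intro finite_imageI finite_covers(2))
  obtain u where u: "covers v u" "h u = Min (h ` {x. covers v x})"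
    using Min_in[OF fin] ne by auto
  obtain w where w: "covers v w" "h w = Max (h ` {x. covers v x})"
    using Max_in[OF fin] ne by auto
  have "x = u \<or> x = w" if x: "covers v x" for x
  proof -
    have "h u \<le> h x" "h x \<le> h w"
      using u w x fin by auto
    moreover have "rk u = rk x" "rk x = rk w"
      using u w x by (auto simp: covers_iff)
    ultimately show ?thesis
      using not_covers_three[OF u(1) x w(1)] inj_h[of u x] inj_h[of x w] by force
  qed
  with u w have "{x. covers v x} = {u, w}"
    by auto
  with that show thesis
    by blast
qed

text \<open>An element strictly between \<open>u\<close> and \<open>w\<close> has a cover because
  \<open>b > 0\<close>. That cover is squeezed onto \<open>v\<close>, so \<open>v\<close> would
  cover three elements.\<close>

lemma adjacent_if_covered:
  assumes "covers v u" "covers v w" "u \<noteq> w"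
  shows "adjacent rk h u w"
proof -
  have b: "b > 0"
    using assms(1) by (rule up_degree_pos)
  have no_between: False
    if "covers v s" "covers v t" "rk z = rk s" "h s < h z" "h z < h t" for s t z
  proof -
    obtain y where y: "z \<le> y" "rk y = Suc (rk z)"
      using exists_above_rk[OF b, of z "Suc (rk z)"] by auto
    then have c: "covers y z"
      by (auto simp: covers_iff le_less)
    have rk: "rk v = Suc (rk s)" "rk v = Suc (rk t)"
      using that by (simp_all add: covers_iff)
    have "y = v"
    proof (rule inj_h)
      show "rk y = rk v"
        using y(2) that(3) rk by simp
      have "h v \<le> h y" "h y \<le> h v"
        using covers_mono_h[OF that(1) c] covers_mono_h[OF c that(2)] that(3-5) rk by simp_all
      then show "h y = h v"
        by simp
    qed
    with c show False
      using not_covers_three that by blast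
  qed
  have "rk u = rk w"
    using assms by (auto simp: covers_iff)
  then show ?thesis
    unfolding adjacent_def using no_between assms by (metis (no_types, lifting))
qed

subsection \<open>Elements covering two elements with a given meet\<close>

text \<open>Root bifurcation relative to a base \<open>m\<close>, the minimum of the copy
  \<open>{m..}\<close>. Covers and meets are still those of the whole poset.\<close>

definition bifurcated_at :: "'a \<Rightarrow> 'a \<Rightarrow> bool" where
  "bifurcated_at m v \<longleftrightarrow> (\<exists>u w. u \<noteq> w \<and> {x. covers v x} = {u, w} \<and> isGlb UNIV {u, w} m)"

lemma root_bifurcated_iff: "root_bifurcated rk h v \<longleftrightarrow> bifurcated_at zero_hat v"
proof -
  have "adjacent rk h u w" if "u \<noteq> w" "{x. covers v x} = {u, w}" for u w
    using that by (intro adjacent_if_covered[of v]) auto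
  then show ?thesis
    unfolding root_bifurcated_def bifurcated_at_def by blast
qed

lemma bifurcated_at_less: "bifurcated_at m v \<Longrightarrow> m < v"
  unfolding bifurcated_at_def isGlb_pair_iff by (force simp: covers_iff)

lemma bifurcated_at_rk:
  assumes "bifurcated_at m v"
  shows "rk m + 2 \<le> rk v"
proof -
  obtain u w where uw: "u \<noteq> w" "{x. covers v x} = {u, w}" "m \<le> u" "m \<le> w"
    using assms by (auto simp: bifurcated_at_def isGlb_pair_iff)
  then have "covers v u" "covers v w"
    by auto
  then have rk: "rk v = Suc (rk u)" "rk u = rk w"
    by (auto simp: covers_iff)
  have "m \<noteq> u \<or> m \<noteq> w"
    using uw by auto
  then have "rk m < rk u"
    using uw rk rk_less by (metis le_less)
  with rk show ?thesis
    by simp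
qed

lemma bifurcated_at_unique:
  assumes "bifurcated_at m v" "bifurcated_at n v"
  shows "m = n"
proof -
  have glb: "\<exists>u w. {x. covers v x} = {u, w} \<and> isGlb UNIV {x. covers v x} k"
    if "bifurcated_at k v" for k
    using that unfolding bifurcated_at_def by metis
  show ?thesis
    using glb[OF assms(1)] glb[OF assms(2)] by (metis isGlb_pair_iff order.antisym)
qed

text \<open>Together with \<open>bifurcated_at_unique\<close> this sorts the elements covering two
  others by the meet of the covered pair.\<close>

lemma covers_two_iff:
  "card {x. covers v x} = 2 \<longleftrightarrow> (\<exists>m. bifurcated_at m v)"
proof
  assume "card {x. covers v x} = 2"
  then obtain u w where uw: "{x. covers v x} = {u, w}" "u \<noteq> w"
    by (auto simp: card_2_iff)
  then have "covers v u" "covers v w"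
    by auto
  then have "rk u = rk w"
    by (auto simp: covers_iff)
  then obtain m where "isGlb UNIV {u, w} m"
    by (rule exists_meet)
  with uw show "\<exists>m. bifurcated_at m v"
    unfolding bifurcated_at_def by blast
qed (auto simp: bifurcated_at_def)

section \<open>Transport of bifurcated elements to the root\<close>

text \<open>An isomorphism \<open>f\<close> of \<open>{m..}\<close> onto the poset preserves covers
  and lowers ranks by \<open>rk m\<close>. It therefore matches the elements bifurcated at
  \<open>m\<close> with the root-bifurcated ones.\<close>

lemma card_bifurcated_at:
  "card {v. rk v = rk m + i \<and> bifurcated_at m v} = num_root_bifurcated rk h i"
proof -
  obtain f where f: "bij_betw f {m..} (UNIV::'a set)"
    and mono: "\<And>x y. m \<le> x \<Longrightarrow> m \<le> y \<Longrightarrow> x \<le> y \<longleftrightarrow> f x \<le> f y"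
    using upho unfolding upho_def order_isomorphic_def by (metis atLeast_iff)
  have inj: "x = y" if "m \<le> x" "m \<le> y" "f x = f y" for x y
    using f that by (auto simp: bij_betw_def inj_on_def)
  have surj: "\<exists>x. m \<le> x \<and> f x = y" for y
  proof -
    have "y \<in> f ` {m..}"
      using f by (auto simp: bij_betw_def)
    then show ?thesis
      by auto
  qed
  have less: "x < y \<longleftrightarrow> f x < f y" if "m \<le> x" "m \<le> y" for x y
    using mono that by (auto simp: less_le_not_le)
  have fm: "f m = zero_hat"
    using surj[of zero_hat] mono zero_hat_le by (metis order.antisym order_refl)
  have cov: "covers y x \<longleftrightarrow> covers (f y) (f x)" if "m \<le> x" "m \<le> y" for x y
  proof -
    have "(\<exists>z. x < z \<and> z < y) \<longleftrightarrow> (\<exists>z. f x < z \<and> z < f y)"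
      using less surj that by (metis order.trans less_imp_le)
    then show ?thesis
      using less that by (auto simp: covers_def)
  qed
  have rk_f: "rk x = rk m + rk (f x)" if "m \<le> x" for x
    using that
  proof (induction "rk x - rk m" arbitrary: x)
    case 0
    then have "m = x"
      by (intro eq_if_le_rk) auto
    then show ?case
      using fm rk_zero_hat by auto
  next
    case (Suc n)
    obtain s where s: "m \<le> s" "s \<le> x" "rk s = rk x - 1"
    proof (rule exists_between_rk[OF Suc.prems])
      show "rk m \<le> rk x - 1" "rk x - 1 \<le> rk x"
        using Suc.hyps(2) by auto
    qed
    then have c: "covers x s"
      using Suc.hyps(2) by (auto simp: covers_iff le_less)
    then have "covers (f x) (f s)"
      using cov s Suc.prems by blast
    moreover have "rk s = rk m + rk (f s)"
      using Suc.hyps s by (intro Suc.hyps(1)) auto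
    ultimately show ?case
      using c by (simp add: covers_iff)
  qed
  have bif: "bifurcated_at m v \<longleftrightarrow> bifurcated_at zero_hat (f v)" if v: "m \<le> v" for v
  proof
    assume "bifurcated_at m v"
    then obtain u w where uw: "u \<noteq> w" "{x. covers v x} = {u, w}"
      and glb: "m \<le> u" "m \<le> w" "\<And>x. x \<le> u \<Longrightarrow> x \<le> w \<Longrightarrow> x \<le> m"
      by (auto simp: bifurcated_at_def isGlb_pair_iff)
    have c: "covers v x \<longleftrightarrow> x = u \<or> x = w" for x
      using uw(2) by auto
    have "covers (f v) y \<longleftrightarrow> y = f u \<or> y = f w" for y
      using surj[of y] cov v c glb(1,2) by metis
    then have "{y. covers (f v) y} = {f u, f w}"
      by auto
    moreover have "f u \<noteq> f w"
      using uw glb inj by blast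
    moreover have "y \<le> zero_hat" if y: "y \<le> f u" "y \<le> f w" for y
    proof -
      obtain x where x: "m \<le> x" "f x = y"
        using surj by blast
      then have "x \<le> m"
        using y glb mono by blast
      then show ?thesis
        using x fm by auto
    qed
    ultimately show "bifurcated_at zero_hat (f v)"
      unfolding bifurcated_at_def isGlb_pair_iff using zero_hat_le by blast
  next
    assume "bifurcated_at zero_hat (f v)"
    then obtain u' w' where uw': "u' \<noteq> w'" "{x. covers (f v) x} = {u', w'}"
      and glb': "\<And>x. x \<le> u' \<Longrightarrow> x \<le> w' \<Longrightarrow> x \<le> zero_hat"
      by (auto simp: bifurcated_at_def isGlb_pair_iff)
    obtain u w where u: "m \<le> u" "f u = u'" and w: "m \<le> w" "f w = w'"
      using surj by metis
    have c: "covers v u" "covers v w"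
      using uw' u w v cov by auto
    have ne: "u \<noteq> w"
      using uw' u w by auto
    have "rk v > 0"
      using c by (auto simp: covers_iff)
    \<comment> \<open>An element covered by \<open>v\<close> might lie outside \<open>{m..}\<close>,
      where \<open>f\<close> says nothing. As \<open>v\<close> covers at most two elements,
      \<open>u\<close> and \<open>w\<close> are all of them.\<close>
    then obtain s t where "{x. covers v x} = {s, t}"
      by (rule covered_eq_pair)
    moreover have "u \<in> {x. covers v x}" "w \<in> {x. covers v x}"
      using c by auto
    ultimately have "{x. covers v x} = {u, w}"
      using ne by auto
    moreover
    have "rk u = rk w"
      using c by (auto simp: covers_iff)
    \<comment> \<open>The same care applies to the meet: taken in the whole poset, it lies above
      \<open>m\<close>, so \<open>f\<close> can be applied to it and sends it to
      \<open>zero_hat\<close>.\<close>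
    then obtain g where g: "isGlb UNIV {u, w} g"
      by (rule exists_meet)
    then have "m \<le> g" "g \<le> u" "g \<le> w"
      using u w by (auto simp: isGlb_pair_iff)
    then have "f g \<le> zero_hat"
      using glb' u w mono by blast
    then have "f g = f m"
      using fm zero_hat_le by (metis order.antisym)
    then have "g = m"
      by (rule inj[OF \<open>m \<le> g\<close> order_refl])
    ultimately show "bifurcated_at m v"
      using g ne unfolding bifurcated_at_def by metis
  qed
  have "bij_betw f {v. rk v = rk m + i \<and> bifurcated_at m v}
      {v. rk v = i \<and> root_bifurcated rk h v}"
    unfolding bij_betw_def root_bifurcated_iff
  proof
    show "inj_on f {v. rk v = rk m + i \<and> bifurcated_at m v}"
    proof (rule inj_onI)
      fix x y
      assume "x \<in> {v. rk v = rk m + i \<and> bifurcated_at m v}"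
        "y \<in> {v. rk v = rk m + i \<and> bifurcated_at m v}" "f x = f y"
      then show "x = y"
        using bifurcated_at_less[of m x] bifurcated_at_less[of m y] inj[of x y] by auto
    qed
    show "f ` {v. rk v = rk m + i \<and> bifurcated_at m v} =
        {v. rk v = i \<and> bifurcated_at zero_hat v}"
    proof (intro equalityI subsetI)
      fix y assume "y \<in> f ` {v. rk v = rk m + i \<and> bifurcated_at m v}"
      then obtain v where v: "y = f v" "rk v = rk m + i" "bifurcated_at m v"
        by blast
      then have "m \<le> v"
        using bifurcated_at_less by (simp add: less_imp_le)
      then show "y \<in> {v. rk v = i \<and> bifurcated_at zero_hat v}"
        using v rk_f[of v] bif by auto
    next
      fix y assume y: "y \<in> {v. rk v = i \<and> bifurcated_at zero_hat v}"
      obtain v where "m \<le> v" "f v = y"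
        using surj by blast
      then show "y \<in> f ` {v. rk v = rk m + i \<and> bifurcated_at m v}"
        using y rk_f[of v] bif by auto
    qed
  qed
  then show ?thesis
    unfolding num_root_bifurcated_def by (rule bij_betw_same_card)
qed

section \<open>The convolution and the double count of covering pairs\<close>

lemma num_root_bifurcated_small:
  assumes "i < 2"
  shows "num_root_bifurcated rk h i = 0"
proof -
  have "{v. rk v = i \<and> root_bifurcated rk h v} = {}"
    using bifurcated_at_rk[of zero_hat] assms by (force simp: root_bifurcated_iff)
  then show ?thesis
    unfolding num_root_bifurcated_def by (simp only: card.empty)
qed

text \<open>Group the elements by the meet \<open>m\<close> of the covered pair, and the meets by
  their rank \<open>j\<close>. By \<open>card_bifurcated_at\<close> the size of a group depends only
  on \<open>k - j\<close>.\<close>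

lemma card_covers_two:
  "card {v. rk v = k \<and> card {x. covers v x} = 2} =
    (\<Sum>j\<le>k. card {x. rk x = j} * num_root_bifurcated rk h (k - j))"
proof -
  let ?B = "\<lambda>m. {v. rk v = k \<and> bifurcated_at m v}"
  have fin: "finite (?B m)" for m
    by (rule finite_subset[OF _ finite_rank[of k]]) auto
  have disj: "?B m \<inter> ?B n = {}" if "m \<noteq> n" for m n
    using that bifurcated_at_unique by blast
  have "{v. rk v = k \<and> card {x. covers v x} = 2} = (\<Union>j\<in>{..k}. \<Union>m\<in>{m. rk m = j}. ?B m)"
  proof (intro set_eqI iffI)
    fix v assume "v \<in> {v. rk v = k \<and> card {x. covers v x} = 2}"
    then obtain m where "rk v = k" "bifurcated_at m v"
      by (auto simp: covers_two_iff)
    then show "v \<in> (\<Union>j\<in>{..k}. \<Union>m\<in>{m. rk m = j}. ?B m)"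
      using bifurcated_at_rk[of m v] by auto
  next
    fix v assume "v \<in> (\<Union>j\<in>{..k}. \<Union>m\<in>{m. rk m = j}. ?B m)"
    then have "rk v = k" "\<exists>m. bifurcated_at m v"
      by auto
    then show "v \<in> {v. rk v = k \<and> card {x. covers v x} = 2}"
      by (simp only: covers_two_iff mem_Collect_eq)
  qed
  also have "card \<dots> = (\<Sum>j\<in>{..k}. card (\<Union>m\<in>{m. rk m = j}. ?B m))"
  proof (rule card_UN_disjoint)
    show "\<forall>j\<in>{..k}. finite (\<Union>m\<in>{m. rk m = j}. ?B m)"
      using fin finite_rank by blast
    show "\<forall>i\<in>{..k}. \<forall>j\<in>{..k}. i \<noteq> j \<longrightarrow>
        (\<Union>m\<in>{m. rk m = i}. ?B m) \<inter> (\<Union>m\<in>{m. rk m = j}. ?B m) = {}"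
    proof (intro ballI impI equals0I)
      fix i j v
      assume "i \<noteq> j"
        and "v \<in> (\<Union>m\<in>{m. rk m = i}. ?B m) \<inter> (\<Union>m\<in>{m. rk m = j}. ?B m)"
      then obtain m n where "bifurcated_at m v" "bifurcated_at n v" "rk m = i" "rk n = j"
        by blast
      with \<open>i \<noteq> j\<close> show False
        using bifurcated_at_unique by blast
    qed
  qed simp
  also have "\<dots> = (\<Sum>j\<le>k. \<Sum>m | rk m = j. card (?B m))"
    by (intro sum.cong refl card_UN_disjoint finite_rank ballI impI fin disj)
  also have "\<dots> = (\<Sum>j\<le>k. \<Sum>m | rk m = j. num_root_bifurcated rk h (k - j))"
  proof (intro sum.cong refl)
    fix j m
    assume "j \<in> {..k}" "m \<in> {m. rk m = j}"
    then show "card (?B m) = num_root_bifurcated rk h (k - j)"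
      using card_bifurcated_at[of m "k - j"] by auto
  qed
  finally show ?thesis
    by simp
qed

lemma double_count:
  "card {x. rk x = Suc k} + card {v. rk v = Suc k \<and> card {x. covers v x} = 2} =
    b * card {x. rk x = k}"
proof -
  let ?S = "{v. rk v = Suc k}" and ?T = "{x. rk x = k}"
  have count: "(\<Sum>v\<in>?S. card {x\<in>?T. covers v x}) = b * card ?T"
  proof (rule sum_multicount[OF finite_rank finite_rank], intro ballI)
    fix x assume "x \<in> ?T"
    then have "{v \<in> ?S. covers v x} = {v. covers v x}"
      by (auto simp: covers_iff)
    then show "card {v \<in> ?S. covers v x} = b"
      by (simp add: card_covers)
  qed
  \<comment> \<open>The rank of \<open>v\<close> is positive, so \<open>covered_eq_pair\<close>
    applies and \<open>v\<close> covers one or two elements.\<close>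
  have "card {x\<in>?T. covers v x} = 1 + (if card {x. covers v x} = 2 then 1 else 0)"
    if v: "v \<in> ?S" for v
  proof -
    have "{x\<in>?T. covers v x} = {x. covers v x}"
      using v by (auto simp: covers_iff)
    moreover obtain u w where "{x. covers v x} = {u, w}"
      using covered_eq_pair[of v] v by auto
    ultimately show ?thesis
      by (cases "u = w") auto
  qed
  then have "(\<Sum>v\<in>?S. card {x\<in>?T. covers v x}) =
      (\<Sum>v\<in>?S. 1 + (if card {x. covers v x} = 2 then 1 else 0))"
    by (intro sum.cong refl)
  also have "\<dots> = card ?S + card {v \<in> ?S. card {x. covers v x} = 2}"
    using finite_rank[of "Suc k"] by (simp only: sum.distrib sum.If_cases Int_def) simp
  also have "{v \<in> ?S. card {x. covers v x} = 2} = {v. rk v = Suc k \<and> card {x. covers v x} = 2}"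
    by auto
  finally show ?thesis
    by (simp only: count)
qed

subsection \<open>Root-bifurcated elements and gaps between atoms\<close>

text \<open>The branches above the atoms \<open>x\<close> and \<open>y\<close> are still separate at
  the neighbours \<open>u\<close> and \<open>w\<close> and join at \<open>v\<close>. That
  \<open>x\<close> and \<open>y\<close> are themselves neighbouring atoms is proved separately, in
  \<open>root_bifurcated_closes_gap\<close>.\<close>

definition closes_gap :: "'a \<Rightarrow> 'a \<Rightarrow> 'a \<Rightarrow> bool" where
  "closes_gap x y v \<longleftrightarrow> rk x = 1 \<and> rk y = 1 \<and> h x < h y \<and>
     (\<exists>u w. covers v u \<and> covers v w \<and> adjacent rk h u w \<and> h u < h w \<and>
        x \<le> u \<and> y \<le> w \<and> \<not> x \<le> w \<and> \<not> y \<le> u)"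

text \<open>Let \<open>x\<close> be the rightmost atom below \<open>u\<close>, the left covered
  element, and \<open>y\<close> the leftmost atom below \<open>w\<close>, the right one. An atom
  between \<open>x\<close> and \<open>y\<close> would also lie below \<open>u\<close> or
  \<open>w\<close>, contradicting one of these choices.\<close>

lemma root_bifurcated_closes_gap:
  assumes "root_bifurcated rk h v"
  obtains x y where "closes_gap x y v" "\<And>z. rk z = 1 \<Longrightarrow> h z \<le> h x \<or> h y \<le> h z"
proof -
  obtain u0 w0 where 0: "u0 \<noteq> w0" "{x. covers v x} = {u0, w0}"
      "adjacent rk h u0 w0" "isGlb UNIV {u0, w0} zero_hat"
    using assms by (auto simp: root_bifurcated_def)
  have "\<exists>u w. h u < h w \<and> {x. covers v x} = {u, w} \<and> adjacent rk h u w \<and>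
      isGlb UNIV {u, w} zero_hat"
  proof (cases "h u0 < h w0")
    case True
    then show ?thesis
      using 0 by blast
  next
    case False
    have "h u0 \<noteq> h w0"
      using 0 inj_h by (auto simp: adjacent_def)
    then have "h w0 < h u0"
      using False by simp
    moreover have "adjacent rk h w0 u0"
      using 0(3) by (auto simp: adjacent_def)
    ultimately show ?thesis
      using 0 by (metis insert_commute)
  qed
  then obtain u w where lt: "h u < h w" and cov: "{x. covers v x} = {u, w}"
    and adj: "adjacent rk h u w" and glb: "isGlb UNIV {u, w} zero_hat"
    by blast
  have c: "covers v u" "covers v w"
    using cov by auto
  have b: "b > 0"
    using c by (auto intro: up_degree_pos)
  have rk: "rk u = rk w"
    using adj by (simp add: adjacent_def)
  have disj: False if "z \<le> u" "z \<le> w" "rk z \<ge> 1" for z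
  proof -
    have "z \<le> zero_hat"
      using glb that by (auto simp: isGlb_pair_iff)
    then show False
      using rk_le[of z zero_hat] rk_zero_hat that by simp
  qed
  have "rk u \<noteq> 0"
    using rk lt by (metis rk_eq_0_iff less_irrefl)
  then have pos: "1 \<le> rk u" "1 \<le> rk w"
    using rk by auto
  define X where "X = {x. rk x = 1 \<and> x \<le> u}"
  define Y where "Y = {y. rk y = 1 \<and> y \<le> w}"
  have fin: "finite (h ` X)" "finite (h ` Y)"
    using finite_rank[of 1] by (auto simp: X_def Y_def)
  have "X \<noteq> {}" "Y \<noteq> {}"
    using exists_below_rk[OF pos(1)] exists_below_rk[OF pos(2)]
    unfolding X_def Y_def by (metis (mono_tags, lifting) empty_iff mem_Collect_eq)+
  then have "Max (h ` X) \<in> h ` X" "Min (h ` Y) \<in> h ` Y"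
    using fin by simp_all
  then obtain x y where x: "x \<in> X" "h x = Max (h ` X)" and y: "y \<in> Y" "h y = Min (h ` Y)"
    by (metis imageE)
  have xmax: "h z \<le> h x" if "z \<in> X" for z
    using that x fin by auto
  have ymin: "h y \<le> h z" if "z \<in> Y" for z
    using that y fin by auto
  have xu: "rk x = 1" "x \<le> u" and yw: "rk y = 1" "y \<le> w"
    using x y by (auto simp: X_def Y_def)
  have nle: "\<not> x \<le> w" "\<not> y \<le> u"
    using disj[of x] disj[of y] xu yw by auto
  \<comment> \<open>Otherwise the chains from \<open>y\<close> to \<open>w\<close> and from
    \<open>x\<close> to \<open>u\<close> cross, giving a common lower bound of \<open>u\<close> and
    \<open>w\<close> of positive rank.\<close>
  have "h x < h y"
  proof (rule ccontr)
    assume "\<not> h x < h y"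
    then have "\<exists>z. y \<le> z \<and> z \<le> w \<and> x \<le> z \<and> z \<le> u"
      using xu yw rk lt by (intro crossing_chains_meet) auto
    then obtain z where "y \<le> z" "z \<le> w" "x \<le> z" "z \<le> u"
      by blast
    then show False
      using disj[of z] rk_le[of y z] yw by simp
  qed
  then have "closes_gap x y v"
    unfolding closes_gap_def using xu yw nle c adj lt by blast
  moreover have "h z \<le> h x \<or> h y \<le> h z" if z: "rk z = 1" for z
  proof (rule ccontr)
    assume "\<not> (h z \<le> h x \<or> h y \<le> h z)"
    then have between: "h x < h z" "h z < h y"
      by auto
    \<comment> \<open>Extend \<open>z\<close> upward to the rank of \<open>u\<close>. By adjacency
      the end \<open>t\<close> is weakly left of \<open>u\<close> or weakly right of
      \<open>w\<close>, so the chain from \<open>z\<close> meets the one from \<open>x\<close> to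
      \<open>u\<close> or the one from \<open>y\<close> to \<open>w\<close>.\<close>
    obtain t where t: "z \<le> t" "rk t = rk u"
      using exists_above_rk[OF b, of z "rk u"] z pos by auto
    then consider "h t \<le> h u" | "h w \<le> h t"
      using adj lt unfolding adjacent_def by force
    then show False
    proof cases
      case 1
      then have "\<exists>s. x \<le> s \<and> s \<le> u \<and> z \<le> s \<and> s \<le> t"
        using xu z t between by (intro crossing_chains_meet) auto
      then have "z \<in> X"
        using z by (auto simp: X_def)
      then show False
        using xmax between by force
    next
      case 2
      then have "\<exists>s. z \<le> s \<and> s \<le> t \<and> y \<le> s \<and> s \<le> w"
        using yw z t between rk by (intro crossing_chains_meet) auto
      then have "z \<in> Y"
        using z by (auto simp: Y_def)
      then show False
        using ymin between by force
    qed
  qed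
  ultimately show thesis
    using that by blast
qed

text \<open>Let \<open>v\<close> have the smaller or equal rank. At equal rank the edges into
  \<open>v\<close> and \<open>v'\<close> force equal positions. At smaller rank, an element above
  \<open>v\<close> at the rank of \<open>u'\<close> lies above both atoms, hence strictly between
  the adjacent \<open>u'\<close> and \<open>w'\<close>.\<close>

lemma closes_gap_unique:
  assumes "closes_gap x y v" "closes_gap x y v'"
  shows "v = v'"
proof -
  have eq: "v = v'" if v: "closes_gap x y v" and v': "closes_gap x y v'" and le: "rk v \<le> rk v'"
    for v v'
  proof -
    have xy: "rk x = 1" "rk y = 1" "h x < h y"
      using v by (auto simp: closes_gap_def)
    obtain u w where c: "covers v u" "covers v w" "h u < h w" "x \<le> u" "y \<le> w"
      using v by (auto simp: closes_gap_def)
    obtain u' w' where c': "covers v' u'" "covers v' w'" "adjacent rk h u' w'" "h u' < h w'"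
        "x \<le> u'" "y \<le> w'" "\<not> x \<le> w'" "\<not> y \<le> u'"
      using v' by (auto simp: closes_gap_def)
    have rk: "rk v = Suc (rk u)" "rk v = Suc (rk w)" "rk v' = Suc (rk u')" "rk v' = Suc (rk w')"
      using c c' by (auto simp: covers_iff)
    \<comment> \<open>If \<open>r\<close> were weakly left of \<open>u'\<close>, the chains from
      \<open>x\<close> to \<open>u'\<close> and from \<open>y\<close> to \<open>r\<close> would
      cross, putting \<open>y\<close> below \<open>u'\<close>. The fact \<open>left\<close> is the
      mirror image.\<close>
    have right: "h u' < h r" if "y \<le> r" "rk r = rk u'" for r
    proof (rule ccontr)
      assume "\<not> h u' < h r"
      then have "\<exists>z. x \<le> z \<and> z \<le> u' \<and> y \<le> z \<and> z \<le> r"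
        using xy c' that by (intro crossing_chains_meet) auto
      then show False
        using c' by (meson order.trans)
    qed
    have left: "h r < h w'" if "x \<le> r" "rk r = rk u'" for r
    proof (rule ccontr)
      assume "\<not> h r < h w'"
      then have "\<exists>z. x \<le> z \<and> z \<le> r \<and> y \<le> z \<and> z \<le> w'"
        using xy c' that rk by (intro crossing_chains_meet) auto
      then show False
        using c' by (meson order.trans)
    qed
    show "v = v'"
    proof (cases "rk v = rk v'")
      case True
      have "h u' < h w" "h u < h w'"
        using right[of w] left[of u] c rk True by auto
      then have "h v' \<le> h v" "h v \<le> h v'"
        using covers_mono_h[of v' u' v w] covers_mono_h[of v u v' w'] c c' rk True by auto
      then show ?thesis
        using True by (intro inj_h) auto
    next
      case False
      have "b > 0"
        using c by (auto intro: up_degree_pos)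
      then obtain r where r: "v \<le> r" "rk r = rk u'"
        using exists_above_rk[of v "rk u'"] le False rk by auto
      have "x \<le> r" "y \<le> r"
        using c r by (auto simp: covers_iff)
      then have "h u' < h r" "h r < h w'"
        using left right r by auto
      then show ?thesis
        using c' r unfolding adjacent_def by force
    qed
  qed
  then show ?thesis
    using assms by (metis linear)
qed

text \<open>Sending \<open>v\<close> to the left atom of its gap is injective, and the rightmost
  atom is never hit. The strict bound needs \<open>b > 0\<close>: for \<open>b = 0\<close> there are
  no atoms.\<close>

lemma finite_root_bifurcated: "finite {v. root_bifurcated rk h v}" (is "finite ?R")
  and card_root_bifurcated: "b > 0 \<Longrightarrow> card {v. root_bifurcated rk h v} < b"
proof -
  let ?A = "{x. rk x = 1}"
  have "\<forall>v. \<exists>x y. root_bifurcated rk h v \<longrightarrow>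
      closes_gap x y v \<and> (\<forall>z. rk z = 1 \<longrightarrow> h z \<le> h x \<or> h y \<le> h z)"
    using root_bifurcated_closes_gap by metis
  then obtain l r where gap: "\<And>v. root_bifurcated rk h v \<Longrightarrow> closes_gap (l v) (r v) v"
    and nxt: "\<And>v z. root_bifurcated rk h v \<Longrightarrow> rk z = 1 \<Longrightarrow> h z \<le> h (l v) \<or> h (r v) \<le> h z"
    by metis
  have lr: "rk (l v) = 1" "rk (r v) = 1" "h (l v) < h (r v)" if "root_bifurcated rk h v" for v
    using gap[OF that] by (auto simp: closes_gap_def)
  have "inj_on l ?R"
  proof (rule inj_onI)
    fix v v' assume R: "v \<in> ?R" "v' \<in> ?R" and eq: "l v = l v'"
    \<comment> \<open>Both right ends are the next atom to the right of the same left end.\<close>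
    then have "h (r v) = h (r v')"
      using nxt[of v "r v'"] nxt[of v' "r v"] lr[of v] lr[of v'] by force
    then have "r v = r v'"
      using lr R by (intro inj_h) auto
    then show "v = v'"
      using gap R eq closes_gap_unique by (metis mem_Collect_eq)
  qed
  moreover have sub: "l ` ?R \<subseteq> ?A"
    using lr by auto
  ultimately show "finite ?R"
    using finite_rank by (metis finite_imageD finite_subset)
  have "?A = {y. covers y zero_hat}"
    using zero_hat_le rk_zero_hat by (auto simp: covers_iff less_le)
  then have card: "card ?A = b"
    using card_covers by simp
  assume "b > 0"
  with card have "?A \<noteq> {}"
    by force
  then have "Max (h ` ?A) \<in> h ` ?A"
    using finite_rank[of 1] by (intro Max_in) auto
  then obtain x where x: "x \<in> ?A" "h x = Max (h ` ?A)"
    by (metis imageE)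
  have "x \<notin> l ` ?R"
  proof
    assume "x \<in> l ` ?R"
    then obtain v where v: "x = l v" "root_bifurcated rk h v"
      by blast
    then have "h (r v) \<le> h x"
      using x lr finite_rank[of 1] by auto
    with v lr show False
      by force
  qed
  then have "card (l ` ?R) < card ?A"
    using sub x finite_rank by (intro psubset_card_mono) auto
  then show "card ?R < b"
    using \<open>inj_on l ?R\<close> card by (simp add: card_image)
qed

lemma sum_num_root_bifurcated_le:
  "finite I \<Longrightarrow> (\<Sum>i\<in>I. num_root_bifurcated rk h i) \<le> card {v. root_bifurcated rk h v}"
proof -
  assume "finite I"
  then have "(\<Sum>i\<in>I. num_root_bifurcated rk h i) =
      card (\<Union>i\<in>I. {v. rk v = i \<and> root_bifurcated rk h v})"
    unfolding num_root_bifurcated_def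
    using finite_root_bifurcated by (intro card_UN_disjoint[symmetric]) auto
  also have "\<dots> \<le> card {v. root_bifurcated rk h v}"
    using finite_root_bifurcated by (intro card_mono) auto
  finally show ?thesis .
qed

lemma finite_num_root_bifurcated: "finite {i. num_root_bifurcated rk h i \<noteq> 0}"
proof (rule finite_subset)
  show "{i. num_root_bifurcated rk h i \<noteq> 0} \<subseteq> rk ` {v. root_bifurcated rk h v}"
    by (auto simp: num_root_bifurcated_def card_eq_0_iff)
qed (use finite_root_bifurcated in simp)

section \<open>The generating function identity\<close>

text \<open>This is \<open>F * Q = 1\<close> arranged without subtraction, so that coefficients can
  be compared as natural numbers. In positive degree it is \<open>double_count\<close> combined with
  \<open>card_covers_two\<close>; in degree 0 it says that \<open>zero_hat\<close> is the only
  element of rank 0.\<close>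

lemma rank_gen_fun_recurrence:
  "rank_gen_fun rk * Abs_fps (\<lambda>i. of_nat (num_root_bifurcated rk h i)) + rank_gen_fun rk =
    1 + fps_const (of_nat b) * fps_X * rank_gen_fun rk"
proof (rule fps_ext)
  let ?F = "rank_gen_fun rk" and ?A = "Abs_fps (\<lambda>i. of_nat (num_root_bifurcated rk h i)) :: rat fps"
  fix k
  have conv: "fps_nth (?F * ?A) k =
      of_nat (\<Sum>i\<le>k. card {x. rk x = i} * num_root_bifurcated rk h (k - i))"
    by (simp add: fps_mult_nth rank_gen_fun_def atLeast0AtMost)
  have shift: "fps_nth (fps_const (of_nat b) * fps_X * ?F) k =
      (if k = 0 then 0 else of_nat (b * card {x. rk x = k - 1}))"
    by (simp add: mult.assoc rank_gen_fun_def)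
  show "fps_nth (?F * ?A + ?F) k = fps_nth (1 + fps_const (of_nat b) * fps_X * ?F) k"
  proof (cases k)
    case 0
    then show ?thesis
      unfolding fps_add_nth conv shift
      by (simp add: rank_gen_fun_def num_root_bifurcated_small rk_eq_0_iff)
  next
    case (Suc j)
    then have "card {x. rk x = k} + (\<Sum>i\<le>k. card {x. rk x = i} *
        num_root_bifurcated rk h (k - i)) = b * card {x. rk x = k - 1}"
      using double_count[of j] by (simp only: card_covers_two diff_Suc_1)
    then have "of_nat (\<Sum>i\<le>k. card {x. rk x = i} * num_root_bifurcated rk h (k - i)) +
        of_nat (card {x. rk x = k}) = (of_nat (b * card {x. rk x = k - 1}) :: rat)"
      unfolding of_nat_add[symmetric] of_nat_eq_iff by (simp only: add.commute)
    with Suc show ?thesis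
      unfolding fps_add_nth conv shift by (simp only: rank_gen_fun_def) simp
  qed
qed

end

theorem theorem4p8:
  fixes rk :: "'a::order \<Rightarrow> nat" and h :: "'a \<Rightarrow> real" and b :: nat and a :: "nat \<Rightarrow> nat"
  assumes "upho rk"
    and "planar_hasse_diagram rk h"
    and "has_up_degree TYPE('a) b"
    and "\<And>i. i \<ge> 2 \<Longrightarrow> a i = num_root_bifurcated rk h i"
  shows "finite {i. i \<ge> 2 \<and> a i \<noteq> 0} \<and>
    (\<forall>n\<ge>1. (\<forall>i>n. a i = 0) \<longrightarrow>
       rank_gen_fun rk = inverse (fps_of_poly (Q_poly b a n)) \<and>
       (b \<ge> 1 \<longrightarrow> poly (Q_poly b a n) 1 \<le> 0))"
proof (intro conjI allI impI)
  interpret planar_upho rk h b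
    using assms by unfold_locales
  note a = assms(4)
  let ?A = "Abs_fps (\<lambda>i. of_nat (num_root_bifurcated rk h i)) :: rat fps"
  show "finite {i. i \<ge> 2 \<and> a i \<noteq> 0}"
    by (rule finite_subset[OF _ finite_num_root_bifurcated]) (auto simp: a)
  fix n :: nat
  assume n: "n \<ge> 1" "\<forall>i>n. a i = 0"
  \<comment> \<open>The sum over \<open>2..n\<close> is the whole series \<open>?A\<close>, because
    the counts vanish below 2 and above \<open>n\<close>.\<close>
  have Q: "fps_of_poly (Q_poly b a n) = 1 - fps_const (of_nat b) * fps_X + ?A"
  proof (rule fps_ext)
    fix k
    have "(\<Sum>i=2..n. coeff (monom (of_nat (a i)) i) k) =
        (\<Sum>i=2..n. if k = i then of_nat (a i) else (0::rat))"
      by (intro sum.cong) auto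
    also have "\<dots> = of_nat (num_root_bifurcated rk h k)"
      using n a num_root_bifurcated_small[of k] by (auto simp: not_le)
    finally show "fps_nth (fps_of_poly (Q_poly b a n)) k =
        fps_nth (1 - fps_const (of_nat b) * fps_X + ?A) k"
      by (auto simp: Q_poly_def coeff_sum)
  qed
  have "fps_of_poly (Q_poly b a n) * rank_gen_fun rk =
      (rank_gen_fun rk * ?A + rank_gen_fun rk) - fps_const (of_nat b) * fps_X * rank_gen_fun rk"
    unfolding Q by (simp add: algebra_simps)
  then have "fps_of_poly (Q_poly b a n) * rank_gen_fun rk = 1"
    by (simp only: rank_gen_fun_recurrence add_diff_cancel_right')
  then show "rank_gen_fun rk = inverse (fps_of_poly (Q_poly b a n))"
    by (metis fps_inverse_unique)
  \<comment> \<open>For \<open>b = 0\<close> the poset is a single point and \<open>Q = 1\<close>.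
    For \<open>b \<ge> 1\<close> the strict inequality in \<open>card_root_bifurcated\<close>
    supplies the constant term 1 of \<open>Q(1)\<close>.\<close>
  assume "b \<ge> 1"
  have "(\<Sum>i=2..n. a i) = (\<Sum>i=2..n. num_root_bifurcated rk h i)"
    by (intro sum.cong) (auto simp: a)
  also have "\<dots> \<le> card {v. root_bifurcated rk h v}"
    by (intro sum_num_root_bifurcated_le) simp
  also have "\<dots> < b"
    using card_root_bifurcated \<open>b \<ge> 1\<close> by simp
  finally have "1 + (\<Sum>i=2..n. a i) \<le> b"
    by simp
  then have "of_nat (1 + (\<Sum>i=2..n. a i)) \<le> (of_nat b :: rat)"
    by (simp only: of_nat_le_iff)
  then show "poly (Q_poly b a n) 1 \<le> 0"
    by (simp add: Q_poly_def poly_sum poly_monom)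
qed

end
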